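(* Let $B$ be a barrier on an infinite set $X\subseteq\mathbb{N}$. For every function $f:B\to\mathbb{N}$ there exists a barrier $B'\subseteq B$ such that for all $s\in B'$, if $f(s)\in b(B')$ then $f(s)\in s$ (where $b(B')=\bigcup B'$ is the base of $B'$).
   Context: $\mathbb{N}$ is the set of natural numbers (including $0$). Subsets of $\mathbb{N}$ are identified with their strictly increasing enumerations; $s\sqsubset Y$ means that $s$ is a proper initial segment of $Y$ as a sequence; $\subset$ is strict set inclusion. A set $B$ of finite subsets of $\mathbb{N}$ is a barrier on an infinite set $X\subseteq\mathbb{N}$ if: (1) $\bigcup B=X$; (2) for all $s,t\in B$, $s\not\subset t$; (3) for every infinite $Y\subseteq X$ there is $s\in B$ with $s\sqsubset Y$. The set $b(B)=\bigcup B$ is called the base of $B$. A family $B'$ is called a barrier if it is a barrier on its base $b(B')$ (in particular $b(B')$ is infinite). *)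

theory Defs
  imports Main "HOL-Library.Infinite_Set"
begin

text \<open>
  A set of natural numbers is identified with its strictly increasing enumeration, which is
  \<^const>\<open>enumerate\<close>. For a finite set \<open>s\<close> only the values of \<open>enumerate s\<close> below \<open>card s\<close> are
  meaningful. A proper initial segment of a sequence is necessarily finite; the disjunction says
  that \<open>Y\<close> is strictly longer than \<open>s\<close>.
\<close>

definition proper_initial_segment :: "nat set \<Rightarrow> nat set \<Rightarrow> bool" where
  "proper_initial_segment s Y \<longleftrightarrow>
     finite s \<and> (infinite Y \<or> card s < card Y) \<and>
     (\<forall>i < card s. enumerate s i = enumerate Y i)"

definition barrier_on :: "nat set set \<Rightarrow> nat set \<Rightarrow> bool" where
  "barrier_on B X \<longleftrightarrow>
     infinite X \<and> (\<forall>s \<in> B. finite s) \<and>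
     \<Union>B = X \<and>
     (\<forall>s \<in> B. \<forall>t \<in> B. \<not> s \<subset> t) \<and>
     (\<forall>Y. Y \<subseteq> X \<and> infinite Y \<longrightarrow> (\<exists>s \<in> B. proper_initial_segment s Y))"

definition base :: "nat set set \<Rightarrow> nat set" where
  "base B = \<Union>B"

definition barrier :: "nat set set \<Rightarrow> bool" where
  "barrier B \<longleftrightarrow> barrier_on B (base B)"

end

theory Submission
  imports Defs
begin

text \<open>
  Restricting a barrier to an infinite subset \<open>Y\<close> of its base gives a barrier on \<open>Y\<close>, so it
  suffices to find an infinite \<open>Y\<close> such that \<open>s \<subseteq> Y\<close> and \<open>f s \<in> Y\<close> imply \<open>f s \<in> s\<close>.
  Such a \<open>Y\<close> is built by fusion from pairs \<open>(F, A)\<close>, with \<open>F\<close> the finite set of elements chosen so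
  far and \<open>A\<close> an infinite reservoir, so that \<open>s \<subseteq> F \<union> A\<close> and \<open>f s \<in> F\<close> imply \<open>f s \<in> s\<close>.
  For the next step take a finite \<open>N \<subseteq> A\<close> with more than \<open>2 ^ card F\<close> elements. By the
  Nash-Williams partition theorem the reservoir can be shrunk so that, for each \<open>t \<subseteq> F\<close>, at most
  one value in \<open>N\<close> is attained by \<open>f\<close> on the members of the barrier of the form \<open>t \<union> u\<close> with
  \<open>u \<subseteq> A\<close>. Hence some element of \<open>N\<close> is never attained, and it can be added to \<open>F\<close>.
\<close>

section \<open>Fusion\<close>

text \<open>Dependent choice iterates \<open>step\<close>, and \<open>Y\<close> collects the chosen
  elements. Every finite \<open>E\<close> in \<open>Y\<close> is captured at some stage, and
  \<open>Y\<close> stays inside \<open>F \<union> A'\<close> of that stage, so what \<open>I\<close>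
  says about subsets of \<open>F \<union> A'\<close> passes to \<open>Y\<close>.\<close>

lemma fusion:
  fixes I :: "'a set \<Rightarrow> 'a set \<Rightarrow> bool"
  assumes "infinite A" "I {} A"
    and step: "\<And>F A. finite F \<Longrightarrow> infinite A \<Longrightarrow> F \<inter> A = {} \<Longrightarrow> I F A \<Longrightarrow>
      \<exists>n A'. n \<in> A \<and> A' \<subseteq> A - {n} \<and> infinite A' \<and> I (insert n F) A'"
  obtains Y where "infinite Y" "Y \<subseteq> A"
    "\<And>E. finite E \<Longrightarrow> E \<subseteq> Y \<Longrightarrow> \<exists>F A'. E \<subseteq> F \<and> Y \<subseteq> F \<union> A' \<and> I F A'"
proof -
  \<comment> \<open>Recording that stage \<open>i\<close> has exactly \<open>i\<close> chosen
    elements makes \<open>Y\<close> infinite.\<close>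
  define J where "J = (\<lambda>i p. finite (fst p) \<and> card (fst p) = i \<and> infinite (snd p) \<and>
    fst p \<inter> snd p = {} \<and> fst p \<union> snd p \<subseteq> A \<and> I (fst p) (snd p))"
  \<comment> \<open>The chosen part grows while its union with the reservoir shrinks; hence every
    later choice lies in \<open>F \<union> A\<close> of each earlier stage.\<close>
  define R where "R = (\<lambda>p q :: 'a set \<times> 'a set.
    fst p \<subseteq> fst q \<and> fst q \<union> snd q \<subseteq> fst p \<union> snd p)"
  have "\<exists>h. \<forall>i. J i (h i) \<and> R (h i) (h (Suc i))"
  proof (rule dependent_nat_choice)
    show "\<exists>p. J 0 p"
      using assms(1,2) by (auto simp: J_def)
  next
    fix p i assume J: "J i p"
    then obtain n A' where "n \<in> snd p" "A' \<subseteq> snd p - {n}" "infinite A'" "I (insert n (fst p)) A'"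
      using step[of "fst p" "snd p"] unfolding J_def by blast
    then have "J (Suc i) (insert n (fst p), A') \<and> R p (insert n (fst p), A')"
      using J by (auto simp: J_def R_def card_insert_if)
    then show "\<exists>q. J (Suc i) q \<and> R p q" ..
  qed
  then obtain h where J: "\<And>i. J i (h i)" and R: "\<And>i. R (h i) (h (Suc i))"
    by blast
  have mono: "R (h i) (h j)" if "i \<le> j" for i j
    using that
  proof (induction rule: dec_induct)
    case base
    show ?case by (simp add: R_def)
  next
    case (step j)
    then show ?case using R[of j] unfolding R_def by blast
  qed
  define Y where "Y = (\<Union>i. fst (h i))"
  have inf: "infinite Y"
  proof
    assume "finite Y"
    moreover have "fst (h (Suc (card Y))) \<subseteq> Y" by (auto simp: Y_def)
    ultimately have "card (fst (h (Suc (card Y)))) \<le> card Y" by (rule card_mono)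
    then show False using J[of "Suc (card Y)"] by (simp add: J_def)
  qed
  have sub: "Y \<subseteq> A"
    using J by (fastforce simp: Y_def J_def)
  have tail: "Y \<subseteq> fst (h i) \<union> snd (h i)" for i
  proof
    fix y assume "y \<in> Y"
    then obtain j where "y \<in> fst (h j)" by (auto simp: Y_def)
    then show "y \<in> fst (h i) \<union> snd (h i)"
      using mono[of i j] mono[of j i] by (cases "i \<le> j") (auto simp: R_def)
  qed
  have fin: "\<exists>i. E \<subseteq> fst (h i)" if "finite E" "E \<subseteq> Y" for E
    using that
  proof (induction rule: finite_induct)
    case (insert y E)
    then obtain i j where "E \<subseteq> fst (h i)" "y \<in> fst (h j)" by (auto simp: Y_def)
    then have "insert y E \<subseteq> fst (h (max i j))"
      using mono[of i "max i j"] mono[of j "max i j"] by (auto simp: R_def)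
    then show ?case ..
  qed simp
  show thesis
  proof (rule that[OF inf sub])
    fix E assume "finite E" "E \<subseteq> Y"
    then obtain i where "E \<subseteq> fst (h i)" using fin by blast
    moreover have "I (fst (h i)) (snd (h i))" using J[of i] by (simp add: J_def)
    ultimately show "\<exists>F A'. E \<subseteq> F \<and> Y \<subseteq> F \<union> A' \<and> I F A'" using tail by blast
  qed
qed

section \<open>The Nash-Williams partition theorem\<close>

text \<open>The colour \<open>c\<close> is taken from \<open>range g\<close> even if no
  \<open>s \<union> u\<close> belongs to \<open>B\<close>, so that a finite range bounds the colours
  in the later pigeonhole argument.\<close>

definition homogeneous :: "'a set set \<Rightarrow> ('a set \<Rightarrow> 'b) \<Rightarrow> 'a set \<Rightarrow> 'a set \<Rightarrow> bool" where
  "homogeneous B g s A \<longleftrightarrow> (\<exists>c \<in> range g. \<forall>u \<subseteq> A. s \<union> u \<in> B \<longrightarrow> g (s \<union> u) = c)"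

lemma homogeneous_mono: "homogeneous B g s A \<Longrightarrow> A' \<subseteq> A \<Longrightarrow> homogeneous B g s A'"
  unfolding homogeneous_def by (meson order_trans)

text \<open>Inclusion in place of initial segments keeps enumerations out of the Ramsey
  argument.\<close>

locale blocking_antichain =
  fixes B :: "nat set set" and X :: "nat set"
  assumes finite_member: "s \<in> B \<Longrightarrow> finite s"
    and antichain: "s \<in> B \<Longrightarrow> t \<in> B \<Longrightarrow> \<not> s \<subset> t"
    and blocking: "Y \<subseteq> X \<Longrightarrow> infinite Y \<Longrightarrow> \<exists>s \<in> B. s \<subseteq> Y"
begin

text \<open>The tree of finite sets that include no member of \<open>B\<close> is well-founded.\<close>

lemma bar_induct [consumes 2, case_names bar step]:
  assumes "finite s" "infinite X"
    and bar: "\<And>s b. b \<in> B \<Longrightarrow> b \<subseteq> s \<Longrightarrow> P s"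
    and step: "\<And>s. finite s \<Longrightarrow> (\<And>n. n \<in> X \<Longrightarrow> n \<notin> s \<Longrightarrow> P (insert n s)) \<Longrightarrow> P s"
  shows "P s"
proof (rule ccontr)
  assume "\<not> P s"
  \<comment> \<open>By \<open>step\<close>, a failure of \<open>P\<close> at
    \<open>s \<union> F\<close> persists after adding some new element of \<open>X\<close>. Fusion
    turns this into an infinite \<open>Y\<close>; a member of \<open>B\<close> inside
    \<open>Y\<close> lies in some \<open>F\<close>, against \<open>bar\<close>.\<close>
  define I where "I = (\<lambda>F A. \<not> P (s \<union> F) \<and> A = X - (s \<union> F))"
  have "infinite (X - s)" using assms(1,2) by simp
  moreover have "I {} (X - s)" using \<open>\<not> P s\<close> by (simp add: I_def)
  moreover have "\<exists>n A'. n \<in> A \<and> A' \<subseteq> A - {n} \<and> infinite A' \<and> I (insert n F) A'"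
    if FA: "finite F" "infinite A" "F \<inter> A = {}" "I F A" for F A
  proof -
    obtain n where "n \<in> X" "n \<notin> s \<union> F" "\<not> P (insert n (s \<union> F))"
      using step[of "s \<union> F"] FA assms(1) unfolding I_def by blast
    then have "n \<in> A \<and> A - {n} \<subseteq> A - {n} \<and> infinite (A - {n}) \<and> I (insert n F) (A - {n})"
      using FA by (auto simp: I_def)
    then show ?thesis by blast
  qed
  ultimately obtain Y where Y: "infinite Y" "Y \<subseteq> X - s"
    "\<And>E. finite E \<Longrightarrow> E \<subseteq> Y \<Longrightarrow> \<exists>F A'. E \<subseteq> F \<and> Y \<subseteq> F \<union> A' \<and> I F A'"
    using fusion[of "X - s" I] by metis
  obtain b where b: "b \<in> B" "b \<subseteq> Y" using blocking[of Y] Y(1,2) by blast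
  then obtain F A' where "b \<subseteq> F" "I F A'" using Y(3)[of b] finite_member by blast
  then show False using bar[OF b(1), of "s \<union> F"] by (auto simp: I_def)
qed

text \<open>Bar induction on \<open>s\<close>. If \<open>s\<close> includes a member of
  \<open>B\<close>, the antichain property leaves at most one candidate \<open>s \<union> u\<close>.
  Otherwise \<open>u\<close> is sorted by its least element \<open>n\<close>, and the induction
  hypothesis is applied to \<open>insert n s\<close>.\<close>

theorem nash_williams_partition:
  assumes "finite (range g)" "finite s" "infinite A" "A \<subseteq> X"
  shows "\<exists>A' \<subseteq> A. infinite A' \<and> homogeneous B g s A'"
proof -
  have "infinite X" using assms(3,4) finite_subset by blast
  with \<open>finite s\<close> show ?thesis
    using assms(3,4)
  proof (induction arbitrary: A rule: bar_induct)
    case (bar s b)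
    have "s \<union> u = b" if "s \<union> u \<in> B" for u
      using antichain[of b "s \<union> u"] bar that by blast
    then have "\<forall>u \<subseteq> A. s \<union> u \<in> B \<longrightarrow> g (s \<union> u) = g b" by metis
    then have "homogeneous B g s A" unfolding homogeneous_def by blast
    with bar show ?case by blast
  next
    case (step s)
    show ?case
    proof (cases "s \<in> B")
      case True
      have "s \<union> u = s" if "s \<union> u \<in> B" for u
        using antichain[of s "s \<union> u"] True that by blast
      then have "\<forall>u \<subseteq> A. s \<union> u \<in> B \<longrightarrow> g (s \<union> u) = g s" by metis
      then have "homogeneous B g s A" unfolding homogeneous_def by blast
      with step.prems show ?thesis by blast
    next
      case False
      \<comment> \<open>Elements are chosen in increasing order, and each chosen \<open>n\<close>
        makes \<open>insert n s\<close> homogeneous on all that can still follow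
        \<open>n\<close>.\<close>
      define I where "I = (\<lambda>F A. A \<subseteq> X - s \<and> (\<forall>m \<in> F. \<forall>n \<in> A. m < n) \<and>
        (\<forall>n \<in> F. homogeneous B g (insert n s) ({m \<in> F. n < m} \<union> A)))"
      have "infinite (A - s)" using step by simp
      moreover have "I {} (A - s)" using step.prems by (auto simp: I_def)
      moreover have "\<exists>n A'. n \<in> A \<and> A' \<subseteq> A - {n} \<and> infinite A' \<and> I (insert n F) A'"
        if FA: "finite F" "infinite A" "F \<inter> A = {}" "I F A" for F A
      proof -
        obtain n where n: "n \<in> A" using \<open>infinite A\<close> by fastforce
        have "infinite (A - {..n})" using \<open>infinite A\<close> by simp
        moreover have "n \<in> X" "n \<notin> s" "A - {..n} \<subseteq> X" using FA(4) n by (auto simp: I_def)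
        ultimately obtain A' where A': "A' \<subseteq> A - {..n}" "infinite A'"
            "homogeneous B g (insert n s) A'"
          using step.IH[of n "A - {..n}"] by blast
        have less: "m < n" if "m \<in> F" for m using \<open>I F A\<close> n that by (auto simp: I_def)
        have "homogeneous B g (insert k s) ({m \<in> insert n F. k < m} \<union> A')"
          if "k \<in> insert n F" for k
        proof (cases "k = n")
          case True
          then have "{m \<in> insert n F. k < m} = {}" using less by fastforce
          then show ?thesis using True A'(3) by (simp only: Un_empty_left)
        next
          case False
          with that have "k \<in> F" by simp
          with \<open>I F A\<close> have "homogeneous B g (insert k s) ({m \<in> F. k < m} \<union> A)"
            unfolding I_def by blast
          moreover have "{m \<in> insert n F. k < m} \<union> A' \<subseteq> {m \<in> F. k < m} \<union> A"
            using A'(1) n by blast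
          ultimately show ?thesis by (rule homogeneous_mono)
        qed
        moreover have "A' \<subseteq> X - s" using FA(4) A'(1) by (auto simp: I_def)
        moreover have "\<forall>m \<in> insert n F. \<forall>k \<in> A'. m < k"
          using FA(4) A'(1) by (auto simp: I_def)
        ultimately have "I (insert n F) A'" by (simp add: I_def)
        then show ?thesis using n A'(1,2) by (intro exI[of _ n] exI[of _ A']) auto
      qed
      ultimately obtain Y where Y: "infinite Y" "Y \<subseteq> A - s"
        "\<And>E. finite E \<Longrightarrow> E \<subseteq> Y \<Longrightarrow> \<exists>F A'. E \<subseteq> F \<and> Y \<subseteq> F \<union> A' \<and> I F A'"
        using fusion[of "A - s" I] by metis
      have "homogeneous B g (insert n s) {m \<in> Y. n < m}" if "n \<in> Y" for n
      proof -
        obtain F A' where F: "n \<in> F" "Y \<subseteq> F \<union> A'" "I F A'" using Y(3)[of "{n}"] \<open>n \<in> Y\<close> by auto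
        then have "homogeneous B g (insert n s) ({m \<in> F. n < m} \<union> A')" by (simp add: I_def)
        then show ?thesis by (rule homogeneous_mono) (use F(2) in blast)
      qed
      then have "\<exists>c. \<forall>n \<in> Y. c n \<in> range g \<and>
          (\<forall>u \<subseteq> {m \<in> Y. n < m}. insert n s \<union> u \<in> B \<longrightarrow> g (insert n s \<union> u) = c n)"
        unfolding homogeneous_def by (intro bchoice) blast
      then obtain c where c: "\<And>n. n \<in> Y \<Longrightarrow> c n \<in> range g"
          "\<And>n u. n \<in> Y \<Longrightarrow> u \<subseteq> {m \<in> Y. n < m} \<Longrightarrow> insert n s \<union> u \<in> B \<Longrightarrow>
            g (insert n s \<union> u) = c n"
        by blast
      have "c ` Y \<subseteq> range g" using c(1) by blast
      then have "finite (c ` Y)" using assms(1) finite_subset by blast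
      \<comment> \<open>The colour \<open>c n\<close> belongs to sets \<open>u\<close> with least
        element \<open>n\<close>; one colour occurs for infinitely many \<open>n\<close>.\<close>
      then obtain k where k: "k \<in> Y" "infinite {n \<in> Y. c n = c k}"
        using pigeonhole_infinite[OF Y(1)] by blast
      have "g (s \<union> u) = c k" if u: "u \<subseteq> {n \<in> Y. c n = c k}" "s \<union> u \<in> B" for u
      proof -
        \<comment> \<open>Since \<open>s\<close> is not in \<open>B\<close>, \<open>u\<close> has a
          least element \<open>n\<close>, which can be moved from \<open>u\<close> to
          \<open>s\<close>.\<close>
        have "u \<noteq> {}" using u(2) False by auto
        then obtain n where n: "n \<in> u" "\<forall>m \<in> u. n \<le> m"
          using exists_least_iff[of "\<lambda>n. n \<in> u"] by (meson ex_in_conv not_less)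
        then have "n \<in> Y" "c n = c k" using u(1) by blast+
        have *: "insert n s \<union> (u - {n}) = s \<union> u" using n(1) by blast
        have "u - {n} \<subseteq> {m \<in> Y. n < m}" using u(1) n(2) by fastforce
        from c(2)[OF \<open>n \<in> Y\<close> this] show ?thesis
          unfolding * using u(2) \<open>c n = c k\<close> by simp
      qed
      then have "homogeneous B g s {n \<in> Y. c n = c k}"
        using c(1) k(1) unfolding homogeneous_def by blast
      moreover have "{n \<in> Y. c n = c k} \<subseteq> A" using Y(2) by blast
      ultimately show ?thesis using k(2) by blast
    qed
  qed
qed

lemma nash_williams_partition_finite:
  assumes "finite (range g)" "finite T" "\<And>t. t \<in> T \<Longrightarrow> finite t" "infinite A" "A \<subseteq> X"
  shows "\<exists>A' \<subseteq> A. infinite A' \<and> (\<forall>t \<in> T. homogeneous B g t A')"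
  using assms(2,3)
proof (induction rule: finite_induct)
  case empty
  then show ?case using assms(4) by auto
next
  case (insert t T)
  then obtain A1 where A1: "A1 \<subseteq> A" "infinite A1" "\<forall>t \<in> T. homogeneous B g t A1" by auto
  then obtain A2 where "A2 \<subseteq> A1" "infinite A2" "homogeneous B g t A2"
    using nash_williams_partition[of g t A1] assms(1,5) insert.prems by blast
  with A1 show ?case by (intro exI[of _ A2]) (auto intro: homogeneous_mono)
qed

section \<open>Infinite sets free for \<open>f\<close>\<close>

lemma avoid_value:
  fixes f :: "nat set \<Rightarrow> nat"
  assumes "finite F" "infinite A" "A \<subseteq> X"
  shows "\<exists>n A'. n \<in> A \<and> A' \<subseteq> A \<and> infinite A' \<and> (\<forall>s \<in> B. s \<subseteq> F \<union> A' \<longrightarrow> f s \<noteq> n)"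
proof -
  obtain N where N: "N \<subseteq> A" "finite N" "card N = Suc (card (Pow F))"
    using infinite_arbitrarily_large[OF assms(2)] by blast
  \<comment> \<open>A finite colouring: \<open>{f s}\<close> if \<open>f s\<close> lies in
    \<open>N\<close>, and the empty set for all other values.\<close>
  define g where "g = (\<lambda>s. {f s} \<inter> N)"
  have "range g \<subseteq> Pow N" by (auto simp: g_def)
  then have "finite (range g)" using N(2) finite_subset by blast
  moreover have "finite t" if "t \<in> Pow F" for t
    using that assms(1) finite_subset by blast
  ultimately obtain A' where A': "A' \<subseteq> A" "infinite A'" "\<forall>t \<in> Pow F. homogeneous B g t A'"
    using nash_williams_partition_finite[of g "Pow F" A] assms by auto
  then obtain c where c: "\<And>t u. t \<subseteq> F \<Longrightarrow> u \<subseteq> A' \<Longrightarrow> t \<union> u \<in> B \<Longrightarrow> g (t \<union> u) = c t"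
    unfolding homogeneous_def by (metis PowI)
  \<comment> \<open>Each trace \<open>t\<close> on \<open>F\<close> accounts for at most one element
    of \<open>N\<close>. If \<open>c t\<close> is no singleton, \<open>the_elem\<close> is
    unspecified, but it still contributes a single value to the count.\<close>
  have "\<not> N \<subseteq> (\<lambda>t. the_elem (c t)) ` Pow F"
  proof
    assume "N \<subseteq> (\<lambda>t. the_elem (c t)) ` Pow F"
    then have "card N \<le> card (Pow F)" using assms(1) by (intro surj_card_le) auto
    with N(3) show False by simp
  qed
  then obtain n where n: "n \<in> N" "n \<notin> (\<lambda>t. the_elem (c t)) ` Pow F" by blast
  have "f s \<noteq> n" if s: "s \<in> B" "s \<subseteq> F \<union> A'" for s
  proof
    assume "f s = n"
    have "(s \<inter> F) \<union> (s \<inter> A') = s" using s(2) by blast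
    then have "c (s \<inter> F) = g s" using c[of "s \<inter> F" "s \<inter> A'"] s(1) by auto
    also have "g s = {n}" using \<open>f s = n\<close> n(1) by (simp add: g_def)
    finally have "the_elem (c (s \<inter> F)) = n" by simp
    then show False using n(2) by blast
  qed
  then show ?thesis using A'(1,2) N(1) n(1) by blast
qed

theorem free_infinite_set:
  fixes f :: "nat set \<Rightarrow> nat"
  assumes "infinite X"
  shows "\<exists>Y \<subseteq> X. infinite Y \<and> (\<forall>s \<in> B. s \<subseteq> Y \<longrightarrow> f s \<in> Y \<longrightarrow> f s \<in> s)"
proof -
  define I where "I = (\<lambda>F A. A \<subseteq> X \<and> (\<forall>s \<in> B. s \<subseteq> F \<union> A \<longrightarrow> f s \<in> F \<longrightarrow> f s \<in> s))"
  have "I {} X" by (simp add: I_def)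
  moreover have "\<exists>n A'. n \<in> A \<and> A' \<subseteq> A - {n} \<and> infinite A' \<and> I (insert n F) A'"
    if FA: "finite F" "infinite A" "F \<inter> A = {}" "I F A" for F A
  proof -
    obtain n A' where nA: "n \<in> A" "A' \<subseteq> A" "infinite A'" "\<forall>s \<in> B. s \<subseteq> F \<union> A' \<longrightarrow> f s \<noteq> n"
      using avoid_value[of F A f] FA unfolding I_def by blast
    have "f s \<in> s" if s: "s \<in> B" "s \<subseteq> insert n F \<union> (A' - {n})" "f s \<in> insert n F" for s
    proof (cases "f s = n")
      case True
      \<comment> \<open>Sets inside \<open>F \<union> A'\<close> never take the value
        \<open>n\<close>, so \<open>s\<close> can only have left \<open>F \<union> A'\<close> by
        containing \<open>n\<close> itself.\<close>
      with nA(4) s(1) have "\<not> s \<subseteq> F \<union> A'" by blast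
      with s(2) True show ?thesis by blast
    next
      case False
      moreover have "s \<subseteq> F \<union> A" using s(2) nA(1,2) by blast
      ultimately show ?thesis using \<open>I F A\<close> s(1,3) by (auto simp: I_def)
    qed
    then have "I (insert n F) (A' - {n})" using \<open>I F A\<close> nA(2) by (auto simp: I_def)
    then show ?thesis using nA(1,2,3) by (intro exI[of _ n] exI[of _ "A' - {n}"]) auto
  qed
  ultimately obtain Y where Y: "infinite Y" "Y \<subseteq> X"
    "\<And>E. finite E \<Longrightarrow> E \<subseteq> Y \<Longrightarrow> \<exists>F A'. E \<subseteq> F \<and> Y \<subseteq> F \<union> A' \<and> I F A'"
    using fusion[of X I] assms by metis
  have "f s \<in> s" if s: "s \<in> B" "s \<subseteq> Y" "f s \<in> Y" for s
  proof -
    \<comment> \<open>It is the value \<open>f s\<close>, not \<open>s\<close>, that has to be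
      captured by a stage.\<close>
    obtain F A' where "f s \<in> F" "Y \<subseteq> F \<union> A'" "I F A'" using Y(3)[of "{f s}"] s(3) by auto
    then show ?thesis using s(1,2) unfolding I_def by blast
  qed
  with Y(1,2) show ?thesis by blast
qed

end

section \<open>Restriction of barriers\<close>

lemma proper_initial_segment_subset:
  assumes "proper_initial_segment s Y" "infinite Y"
  shows "s \<subseteq> Y"
proof
  fix x assume "x \<in> s"
  have "finite s" using assms(1) by (simp add: proper_initial_segment_def)
  then obtain i where "i < card s" "enumerate s i = x"
    using finite_enumerate_Ex \<open>x \<in> s\<close> by blast
  then have "x = enumerate Y i" using assms(1) by (auto simp: proper_initial_segment_def)
  then show "x \<in> Y" using enumerate_in_set[OF assms(2)] by simp
qed

lemma proper_initial_segment_Least: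
  assumes "proper_initial_segment s Y" "s \<noteq> {}"
  shows "(LEAST n. n \<in> Y) \<in> s"
proof -
  have "finite s" using assms(1) by (simp add: proper_initial_segment_def)
  then have "0 < card s" using assms(2) by (simp add: card_gt_0_iff)
  then have "enumerate s 0 \<in> s" "enumerate s 0 = enumerate Y 0"
    using assms(1) finite_enumerate_in_set[OF \<open>finite s\<close>]
    unfolding proper_initial_segment_def by blast+
  then show ?thesis by (simp add: enumerate_0)
qed

text \<open>The empty set is strictly below every other set, so it would be the only member, and the
  base would be empty instead of infinite.\<close>

lemma barrier_on_nonempty:
  assumes "barrier_on B X" "s \<in> B"
  shows "s \<noteq> {}"
proof
  assume "s = {}"
  with assms have "\<forall>t \<in> B. t = {}" unfolding barrier_on_def by blast
  then have "\<Union>B = {}" by blast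
  with assms(1) show False by (auto simp: barrier_on_def)
qed

lemma barrier_on_restrict:
  assumes B: "barrier_on B X" and Y: "Y \<subseteq> X" "infinite Y"
  shows "barrier_on {s \<in> B. s \<subseteq> Y} Y"
proof -
  have seg: "\<exists>s \<in> {s \<in> B. s \<subseteq> Y}. proper_initial_segment s Z" if Z: "Z \<subseteq> Y" "infinite Z" for Z
  proof -
    obtain s where "s \<in> B" "proper_initial_segment s Z"
      using B Z Y(1) unfolding barrier_on_def by (meson order_trans)
    then show ?thesis using proper_initial_segment_subset Z by blast
  qed
  have "y \<in> \<Union>{s \<in> B. s \<subseteq> Y}" if "y \<in> Y" for y
  proof -
    \<comment> \<open>The tail of \<open>Y\<close> from \<open>y\<close> on has least element
      \<open>y\<close>, which therefore belongs to each of its nonempty initial segments.\<close>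
    let ?Z = "Y - {..<y}"
    have "infinite ?Z" using Y(2) by simp
    then obtain s where s: "s \<in> B" "s \<subseteq> Y" "proper_initial_segment s ?Z"
      using seg[of ?Z] by blast
    have "(LEAST n. n \<in> ?Z) = y" using that by (intro Least_equality) auto
    then have "y \<in> s"
      using proper_initial_segment_Least[OF s(3) barrier_on_nonempty[OF B s(1)]] by simp
    with s show ?thesis by blast
  qed
  then have "\<Union>{s \<in> B. s \<subseteq> Y} = Y" by blast
  then show ?thesis using B Y(2) seg unfolding barrier_on_def by auto
qed

lemma barrier_on_blocking_antichain:
  assumes "barrier_on B X"
  shows "blocking_antichain B X"
proof
  fix Y assume "Y \<subseteq> X" "infinite Y"
  then show "\<exists>s \<in> B. s \<subseteq> Y"
    using assms proper_initial_segment_subset unfolding barrier_on_def by meson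
qed (use assms in \<open>auto simp: barrier_on_def\<close>)

theorem mainTheorem1:
  fixes B :: "nat set set" and X :: "nat set" and f :: "nat set \<Rightarrow> nat"
  assumes "infinite X" and "barrier_on B X"
  shows "\<exists>B'. B' \<subseteq> B \<and> barrier B' \<and> (\<forall>s \<in> B'. f s \<in> base B' \<longrightarrow> f s \<in> s)"
proof -
  interpret blocking_antichain B X
    using assms(2) by (rule barrier_on_blocking_antichain)
  obtain Y where Y: "Y \<subseteq> X" "infinite Y" "\<forall>s \<in> B. s \<subseteq> Y \<longrightarrow> f s \<in> Y \<longrightarrow> f s \<in> s"
    using free_infinite_set[OF assms(1)] by blast
  let ?B' = "{s \<in> B. s \<subseteq> Y}"
  have "barrier_on ?B' Y" using assms(2) Y(1,2) by (rule barrier_on_restrict)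
  moreover from this have "base ?B' = Y" by (simp add: barrier_on_def base_def)
  ultimately show ?thesis using Y(3) by (intro exI[of _ ?B']) (auto simp: barrier_def)
qed

end
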